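(* Let $V$ and $W$ be complex vector spaces with $\dim V=c\geq 1$ and $\dim W=r=1$. Then there are no $\mathbb{C}$-stable solutions $\vec B=(B_{kl},i_k,j_k)_{k,l=1,2}$, with $B_{kl}\in\mathrm{End}(V)$, $i_k\in\mathrm{Hom}(W,V)$, $j_k\in\mathrm{Hom}(V,W)$, of the complex ADHM equations $$[B_{11},B_{12}]+i_1j_1=0,\quad [B_{21},B_{22}]+i_2j_2=0,\quad [B_{11},B_{22}]+[B_{21},B_{12}]+i_1j_2+i_2j_1=0.$$
   Context: A tuple $(B_1,B_2,i,j)$ with $B_1,B_2\in\mathrm{End}(V)$, $i\in\mathrm{Hom}(W,V)$, $j\in\mathrm{Hom}(V,W)$ is stable if there is no proper subspace $S\subsetneq V$ with $B_k(S)\subset S$ ($k=1,2$) and $i(W)\subset S$. For $p=[z:w]\in\mathbb{P}^1$ put $\vec B_p=(zB_{11}+wB_{21},\,zB_{12}+wB_{22},\,zi_1+wi_2,\,zj_1+wj_2)$ (well defined up to a nonzero scalar). $\vec B$ is $\mathbb{C}$-stable if $\vec B_p$ is stable for all $p\in\mathbb{P}^1$. *)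

theory Defs
  imports Complex_Main
begin

text \<open>
  Complex vector spaces \<open>V\<close>, \<open>W\<close> are represented by abelian-group types with explicit scalar
  multiplications \<open>sV\<close>, \<open>sW\<close> satisfying \<^locale>\<open>vector_space\<close> over \<^typ>\<open>complex\<close>.
  Since \<open>vector_space.dim\<close> is \<open>0\<close> on infinite-dimensional spaces, a positive dimension entails
  finite-dimensionality.
\<close>

definition commutator :: "('v::ab_group_add \<Rightarrow> 'v) \<Rightarrow> ('v \<Rightarrow> 'v) \<Rightarrow> 'v \<Rightarrow> 'v" where
  "commutator A B = (\<lambda>v. A (B v) - B (A v))"

text \<open>The component \<open>j\<close> does not enter the condition; it is kept because stability is a property
  of the whole tuple.\<close>

definition adhm_stable ::
  "(complex \<Rightarrow> 'v::ab_group_add \<Rightarrow> 'v) \<Rightarrow> ('v \<Rightarrow> 'v) \<Rightarrow> ('v \<Rightarrow> 'v) \<Rightarrow> ('w \<Rightarrow> 'v) \<Rightarrow> ('v \<Rightarrow> 'w) \<Rightarrow> bool"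
where
  "adhm_stable sV B1 B2 i j \<longleftrightarrow>
     \<not> (\<exists>S. module.subspace sV S \<and> S \<subset> UNIV \<and> B1 ` S \<subseteq> S \<and> B2 ` S \<subseteq> S \<and> range i \<subseteq> S)"

definition lin_comb ::
  "(complex \<Rightarrow> 'b::ab_group_add \<Rightarrow> 'b) \<Rightarrow> complex \<Rightarrow> complex \<Rightarrow> ('a \<Rightarrow> 'b) \<Rightarrow> ('a \<Rightarrow> 'b) \<Rightarrow> 'a \<Rightarrow> 'b"
where
  "lin_comb s z w f g = (\<lambda>x. s z (f x) + s w (g x))"

text \<open>The points \<open>[z:w]\<close> of the projective line are given by all their homogeneous coordinates
  \<open>(z, w) \<noteq> (0, 0)\<close>; by \<open>adhm_stable_rescale\<close> below, the choice of coordinates is irrelevant.\<close>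

definition C_stable ::
  "(complex \<Rightarrow> 'v::ab_group_add \<Rightarrow> 'v) \<Rightarrow> (complex \<Rightarrow> 'w::ab_group_add \<Rightarrow> 'w) \<Rightarrow>
   ('v \<Rightarrow> 'v) \<Rightarrow> ('v \<Rightarrow> 'v) \<Rightarrow> ('v \<Rightarrow> 'v) \<Rightarrow> ('v \<Rightarrow> 'v) \<Rightarrow>
   ('w \<Rightarrow> 'v) \<Rightarrow> ('w \<Rightarrow> 'v) \<Rightarrow> ('v \<Rightarrow> 'w) \<Rightarrow> ('v \<Rightarrow> 'w) \<Rightarrow> bool"
where
  "C_stable sV sW B11 B12 B21 B22 i1 i2 j1 j2 \<longleftrightarrow>
     (\<forall>z w. (z, w) \<noteq> (0, 0) \<longrightarrow>
        adhm_stable sV (lin_comb sV z w B11 B21) (lin_comb sV z w B12 B22)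
          (lin_comb sV z w i1 i2) (lin_comb sW z w j1 j2))"

definition complex_ADHM ::
  "('v::ab_group_add \<Rightarrow> 'v) \<Rightarrow> ('v \<Rightarrow> 'v) \<Rightarrow> ('v \<Rightarrow> 'v) \<Rightarrow> ('v \<Rightarrow> 'v) \<Rightarrow>
   ('w \<Rightarrow> 'v) \<Rightarrow> ('w \<Rightarrow> 'v) \<Rightarrow> ('v \<Rightarrow> 'w) \<Rightarrow> ('v \<Rightarrow> 'w) \<Rightarrow> bool"
where
  "complex_ADHM B11 B12 B21 B22 i1 i2 j1 j2 \<longleftrightarrow>
     (\<forall>v. commutator B11 B12 v + i1 (j1 v) = 0) \<and>
     (\<forall>v. commutator B21 B22 v + i2 (j2 v) = 0) \<and>
     (\<forall>v. commutator B11 B22 v + commutator B21 B12 v + i1 (j2 v) + i2 (j1 v) = 0)"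

lemma subspace_scale_image_iff:
  fixes sV :: "complex \<Rightarrow> 'v::ab_group_add \<Rightarrow> 'v"
  assumes "vector_space sV" "module.subspace sV S" "t \<noteq> 0"
  shows "sV t x \<in> S \<longleftrightarrow> x \<in> S"
proof -
  interpret vector_space sV by fact
  show ?thesis
    using assms(2,3) by (metis subspace_scale scale_scale left_inverse scale_one)
qed

lemma adhm_stable_rescale:
  fixes sV :: "complex \<Rightarrow> 'v::ab_group_add \<Rightarrow> 'v"
    and sW :: "complex \<Rightarrow> 'w::ab_group_add \<Rightarrow> 'w"
  assumes "vector_space sV" "t \<noteq> 0"
  shows "adhm_stable sV (lin_comb sV (t * z) (t * w) B11 B21) (lin_comb sV (t * z) (t * w) B12 B22)
           (lin_comb sV (t * z) (t * w) i1 i2) (lin_comb sW (t * z) (t * w) j1 j2) \<longleftrightarrow>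
         adhm_stable sV (lin_comb sV z w B11 B21) (lin_comb sV z w B12 B22)
           (lin_comb sV z w i1 i2) (lin_comb sW z w j1 j2)"
proof -
  interpret vector_space sV by fact
  have *: "lin_comb sV (t * z) (t * w) f g = (\<lambda>x. sV t (lin_comb sV z w f g x))"
    for f g :: "'c \<Rightarrow> 'v"
    by (simp add: lin_comb_def scale_right_distrib)
  show ?thesis
    unfolding adhm_stable_def *
    using subspace_scale_image_iff[OF assms(1) _ assms(2)]
    by (auto simp: image_subset_iff)
qed

end

theory Submission
  imports Defs "HOL-Complex_Analysis.Laurent_Convergence"
begin

text \<open>Fix a vector \<open>w0\<close> spanning \<open>W\<close>. For \<open>r = 1\<close>, stability forces \<open>j_p = 0\<close> (a trace argument), so
  at every \<open>p\<close> the operators \<open>B_1(p)\<close>, \<open>B_2(p)\<close> commute and \<open>e(p) = i_p(w0)\<close> is a cyclic vector.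
  Hence for each \<open>v\<close> there is a unique operator \<open>M_p\<close> commuting with \<open>B_1(p)\<close>, \<open>B_2(p)\<close> and sending
  \<open>e(p)\<close> to \<open>v\<close>. Its matrix entries are holomorphic in the homogeneous coordinates of \<open>p\<close> and
  homogeneous of degree \<open>-1\<close>, so they vanish by Liouville's theorem, and \<open>v = M_p e(p) = 0\<close>.\<close>

section \<open>Linear systems with analytic coefficients, and sections on the projective
  line\<close>

text \<open>Gaussian elimination with a parameter: the matrix is the identity at \<open>a\<close>,
  so the pivot is nonzero near \<open>a\<close>, and the reduced system is again the identity at
  \<open>a\<close>, which keeps the induction on \<open>I\<close> going.\<close>

lemma analytic_at_linear_system:
  fixes C :: "'i \<Rightarrow> 'i \<Rightarrow> complex \<Rightarrow> complex"
  assumes "finite I"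
    and "\<And>k l. k \<in> I \<Longrightarrow> l \<in> I \<Longrightarrow> C k l analytic_on {a}"
    and "\<And>k l. k \<in> I \<Longrightarrow> l \<in> I \<Longrightarrow> C k l a = (if k = l then 1 else 0)"
    and "\<And>k. k \<in> I \<Longrightarrow> f k analytic_on {a}"
  shows "\<exists>x. (\<forall>l\<in>I. x l analytic_on {a}) \<and>
           (\<forall>\<^sub>F t in nhds a. \<forall>k\<in>I. (\<Sum>l\<in>I. C k l t * x l t) = f k t)"
  using assms
proof (induction I arbitrary: C f rule: finite_induct)
  case empty
  then show ?case by simp
next
  case (insert i I)
  note an = insert.prems(1,3) and C_a = insert.prems(2)
  have nz: "C i i a \<noteq> 0"
    using C_a by simp
  \<comment> \<open>Schur complement after eliminating unknown \<open>i\<close>. The correction to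
    \<open>C\<close> vanishes at \<open>a\<close> because the off-diagonal entries do.\<close>
  define C' where "C' = (\<lambda>k l t. C k l t - C k i t * C i l t / C i i t)"
  define f' where "f' = (\<lambda>k t. f k t - C k i t * f i t / C i i t)"
  have "\<exists>x. (\<forall>l\<in>I. x l analytic_on {a}) \<and>
           (\<forall>\<^sub>F t in nhds a. \<forall>k\<in>I. (\<Sum>l\<in>I. C' k l t * x l t) = f' k t)"
  proof (rule insert.IH)
    show "C' k l analytic_on {a}" if "k \<in> I" "l \<in> I" for k l
      unfolding C'_def using that nz by (intro analytic_intros an) auto
    show "C' k l a = (if k = l then 1 else 0)" if "k \<in> I" "l \<in> I" for k l
      using that insert.hyps C_a by (auto simp: C'_def)
    show "f' k analytic_on {a}" if "k \<in> I" for k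
      unfolding f'_def using that nz by (intro analytic_intros an) auto
  qed
  then obtain x where x: "\<And>l. l \<in> I \<Longrightarrow> x l analytic_on {a}"
    and ev: "\<forall>\<^sub>F t in nhds a. \<forall>k\<in>I. (\<Sum>l\<in>I. C' k l t * x l t) = f' k t"
    by blast
  \<comment> \<open>Back-substitution: row \<open>i\<close> is solved for the eliminated
    unknown.\<close>
  define y where "y = x(i := (\<lambda>t. (f i t - (\<Sum>l\<in>I. C i l t * x l t)) / C i i t))"
  have yI: "y l = x l" if "l \<in> I" for l
    using that insert.hyps by (auto simp: y_def)
  have "(\<lambda>t. (f i t - (\<Sum>l\<in>I. C i l t * x l t)) / C i i t) analytic_on {a}"
    using nz by (intro analytic_intros an x) auto
  then have "\<forall>l\<in>insert i I. y l analytic_on {a}"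
    using x yI by (simp add: y_def)
  moreover have "\<forall>\<^sub>F t in nhds a. C i i t \<noteq> 0"
  proof -
    have "isCont (C i i) a"
      using an(1)[of i i] by (simp add: analytic_at_imp_isCont)
    then have "(C i i \<longlongrightarrow> C i i a) (nhds a)"
      by (simp add: continuous_at tendsto_at_iff_tendsto_nhds)
    then show ?thesis
      using nz by (rule tendsto_imp_eventually_ne)
  qed
  with ev have "\<forall>\<^sub>F t in nhds a. \<forall>k\<in>insert i I. (\<Sum>l\<in>insert i I. C k l t * y l t) = f k t"
  proof eventually_elim
    case (elim t)
    have sum: "(\<Sum>l\<in>insert i I. C k l t * y l t) = C k i t * y i t + (\<Sum>l\<in>I. C k l t * x l t)" for k
      using insert.hyps yI by simp
    have yi: "y i t = (f i t - (\<Sum>l\<in>I. C i l t * x l t)) / C i i t"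
      by (simp add: y_def)
    have "(\<Sum>l\<in>insert i I. C k l t * y l t) = f k t" if "k \<in> I" for k
    proof -
      have "f' k t = (\<Sum>l\<in>I. C' k l t * x l t)"
        using elim(1) that by simp
      also have "\<dots> = (\<Sum>l\<in>I. C k l t * x l t - C k i t / C i i t * (C i l t * x l t))"
        by (simp add: C'_def left_diff_distrib mult.assoc)
      also have "\<dots> = (\<Sum>l\<in>I. C k l t * x l t) - C k i t / C i i t * (\<Sum>l\<in>I. C i l t * x l t)"
        by (simp add: sum_subtractf sum_distrib_left)
      finally show ?thesis
        unfolding sum yi f'_def by (simp add: diff_divide_distrib algebra_simps)
    qed
    moreover have "(\<Sum>l\<in>insert i I. C i l t * y l t) = f i t"
      unfolding sum yi using elim(2) by simp
    ultimately show ?case by blast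
  qed
  ultimately show ?case by blast
qed

text \<open>The line bundle \<open>O(-1)\<close> on the projective line has no global sections.\<close>

lemma degree_minus_one_section_eq_0:
  fixes g h :: "complex \<Rightarrow> complex"
  assumes "g analytic_on UNIV" and "h analytic_on UNIV"
    and glue: "\<And>t. t \<noteq> 0 \<Longrightarrow> g t = h (inverse t) * inverse t"
  shows "g t = 0"
proof (rule Liouville_weak_0[of g])
  show "g holomorphic_on UNIV"
    using assms(1) by (simp add: analytic_on_open)
  \<comment> \<open>Near infinity \<open>h (inverse t)\<close> tends to \<open>h 0\<close>, so the
    transition factor \<open>inverse t\<close> forces \<open>g\<close> to decay.\<close>
  have "isCont h 0"
    using assms(2) by (metis UNIV_I analytic_at_imp_isCont analytic_on_analytic_at)
  then have "((\<lambda>t. h (inverse t)) \<longlongrightarrow> h 0) at_infinity"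
    by (rule isCont_tendsto_compose) (rule tendsto_inverse_0)
  then have "((\<lambda>t. h (inverse t) * inverse t) \<longlongrightarrow> h 0 * 0) at_infinity"
    by (intro tendsto_mult tendsto_inverse_0)
  moreover have "\<forall>\<^sub>F t::complex in at_infinity. t \<noteq> 0"
    by (rule eventually_not_equal_at_infinity)
  then have "\<forall>\<^sub>F t in at_infinity. h (inverse t) * inverse t = g t"
    by eventually_elim (simp add: glue)
  ultimately show "(g \<longlongrightarrow> 0) at_infinity"
    by (auto elim: Lim_transform_eventually)
qed

section \<open>Cyclic vectors and operators commuting with a pair\<close>

text \<open>Characteristic zero serves the trace argument, which ends by cancelling a positive
  integer.\<close>

locale fd_vector_space_char_0 = finite_dimensional_vector_space scale Basis
  for scale :: "'a::field_char_0 \<Rightarrow> 'b::ab_group_add \<Rightarrow> 'b" (infixr \<open>\<odot>\<close> 75)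
    and Basis :: "'b set"
begin

text \<open>Stability for one-dimensional \<open>W\<close>, with the image of \<open>i\<close>
  replaced by a vector \<open>e\<close> spanning it.\<close>

definition generates :: "('b \<Rightarrow> 'b) \<Rightarrow> ('b \<Rightarrow> 'b) \<Rightarrow> 'b \<Rightarrow> bool" where
  "generates B1 B2 e \<longleftrightarrow>
     (\<forall>S. subspace S \<longrightarrow> B1 ` S \<subseteq> S \<longrightarrow> B2 ` S \<subseteq> S \<longrightarrow> e \<in> S \<longrightarrow> S = UNIV)"

text \<open>For commuting \<open>B1\<close>, \<open>B2\<close> with cyclic vector \<open>e\<close>,
  the space is a quotient ring of the polynomials in two variables with unit \<open>e\<close>; then
  \<open>M\<close> is multiplication by \<open>v\<close>.\<close>

definition commuting_op :: "('b \<Rightarrow> 'b) \<Rightarrow> ('b \<Rightarrow> 'b) \<Rightarrow> 'b \<Rightarrow> 'b \<Rightarrow> ('b \<Rightarrow> 'b) \<Rightarrow> bool" where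
  "commuting_op B1 B2 e v M \<longleftrightarrow> Vector_Spaces.linear scale scale M \<and>
     (\<forall>u. M (B1 u) = B1 (M u)) \<and> (\<forall>u. M (B2 u) = B2 (M u)) \<and> M e = v"

text \<open>The set where two such operators agree is an invariant subspace containing
  \<open>e\<close>.\<close>

lemma commuting_op_unique:
  assumes gen: "generates B1 B2 e"
    and M: "commuting_op B1 B2 e v M" and N: "commuting_op B1 B2 e v N"
  shows "M = N"
proof -
  interpret M: Vector_Spaces.linear scale scale M using M by (simp add: commuting_op_def)
  interpret N: Vector_Spaces.linear scale scale N using N by (simp add: commuting_op_def)
  have "{u. M u = N u} = UNIV"
  proof (rule gen[unfolded generates_def, rule_format])
    show "subspace {u. M u = N u}"
      by (simp add: subspace_def M.add N.add M.scale N.scale)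
  qed (use M N in \<open>auto simp: commuting_op_def\<close>)
  then show ?thesis by blast
qed

text \<open>The source of the degree -1: scaling \<open>B1\<close> and \<open>B2\<close> preserves
  the commutation, while scaling \<open>e\<close> with fixed target \<open>v\<close> forces the
  factor \<open>inverse s\<close>.\<close>

lemma commuting_op_rescale:
  assumes M: "commuting_op B1 B2 e v M" and "s \<noteq> 0"
    and B: "Vector_Spaces.linear scale scale B1" "Vector_Spaces.linear scale scale B2"
  shows "commuting_op (\<lambda>u. s \<odot> B1 u) (\<lambda>u. s \<odot> B2 u) (s \<odot> e) v (\<lambda>u. inverse s \<odot> M u)"
proof -
  interpret M: Vector_Spaces.linear scale scale M using M by (simp add: commuting_op_def)
  have "Vector_Spaces.linear scale scale (\<lambda>u. inverse s \<odot> M u)"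
    by (auto simp: Vector_Spaces.linear_iff M.add M.scale scale_right_distrib mult.commute
        vector_space_axioms)
  then show ?thesis
    using assms by (auto simp: commuting_op_def Vector_Spaces.linear_iff)
qed

text \<open>A definite description makes the operator depend on \<open>B1\<close>,
  \<open>B2\<close>, \<open>e\<close>, \<open>v\<close> alone, so that different local constructions
  of it must agree.\<close>

definition multiplier :: "('b \<Rightarrow> 'b) \<Rightarrow> ('b \<Rightarrow> 'b) \<Rightarrow> 'b \<Rightarrow> 'b \<Rightarrow> 'b \<Rightarrow> 'b" where
  "multiplier B1 B2 e v = (THE M. commuting_op B1 B2 e v M)"

lemma multiplier_eq:
  assumes "generates B1 B2 e" "commuting_op B1 B2 e v M"
  shows "multiplier B1 B2 e v = M"
  unfolding multiplier_def using assms commuting_op_unique by blast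

abbreviation coord :: "'b \<Rightarrow> 'b \<Rightarrow> 'a" where
  "coord b v \<equiv> representation Basis v b"

lemma coord_add: "coord b (u + v) = coord b u + coord b v"
  by (simp add: representation_add independent_Basis span_Basis)

lemma coord_scale: "coord b (s \<odot> v) = s * coord b v"
  by (simp add: representation_scale independent_Basis span_Basis)

lemma coord_sum: "coord b (\<Sum>i\<in>I. f i) = (\<Sum>i\<in>I. coord b (f i))"
  by (simp add: representation_sum independent_Basis span_Basis)

lemma coord_Basis: "c \<in> Basis \<Longrightarrow> coord b c = (if b = c then 1 else 0)"
  by (auto simp: representation_basis independent_Basis)

lemma sum_coord: "(\<Sum>b\<in>Basis. coord b v \<odot> b) = v"
  by (rule sum_representation_eq) (auto simp: independent_Basis span_Basis finite_Basis)

lemma eq_if_coord_eq: "u = v" if "\<And>b. b \<in> Basis \<Longrightarrow> coord b u = coord b v"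
proof -
  have "(\<Sum>b\<in>Basis. coord b u \<odot> b) = (\<Sum>b\<in>Basis. coord b v \<odot> b)"
    using that by simp
  then show ?thesis by (simp add: sum_coord)
qed

lemma coord_linear_image:
  assumes "Vector_Spaces.linear scale scale f"
  shows "coord b (f v) = (\<Sum>c\<in>Basis. coord c v * coord b (f c))"
proof -
  interpret f: Vector_Spaces.linear scale scale f by fact
  have "f v = (\<Sum>c\<in>Basis. coord c v \<odot> f c)"
    by (subst (1) sum_coord[of v, symmetric]) (simp add: f.sum f.scale)
  then show ?thesis
    by (simp add: coord_sum coord_scale)
qed

section \<open>Traces and the ADHM equation in rank one\<close>

definition trace_op :: "('b \<Rightarrow> 'b) \<Rightarrow> 'a" where
  "trace_op f = (\<Sum>b\<in>Basis. coord b (f b))"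

lemma trace_op_commute:
  assumes "Vector_Spaces.linear scale scale f" "Vector_Spaces.linear scale scale g"
  shows "trace_op (\<lambda>v. f (g v)) = trace_op (\<lambda>v. g (f v))"
proof -
  have "trace_op (\<lambda>v. f (g v)) = (\<Sum>b\<in>Basis. \<Sum>c\<in>Basis. coord c (g b) * coord b (f c))"
    unfolding trace_op_def by (subst coord_linear_image[OF assms(1)]) simp
  also have "\<dots> = (\<Sum>c\<in>Basis. \<Sum>b\<in>Basis. coord b (f c) * coord c (g b))"
    by (subst sum.swap) (simp add: mult.commute)
  also have "\<dots> = trace_op (\<lambda>v. g (f v))"
    unfolding trace_op_def by (subst (2) coord_linear_image[OF assms(2)]) simp
  finally show ?thesis .
qed

lemma trace_op_add: "trace_op (\<lambda>v. f v + g v) = trace_op f + trace_op g"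
  by (simp add: trace_op_def coord_add sum.distrib)

text \<open>Turns the rank-one term of the ADHM equation into a scalar.\<close>

lemma trace_op_rank_one:
  assumes "Vector_Spaces.linear scale (*) \<phi>"
  shows "trace_op (\<lambda>v. \<phi> v \<odot> u) = \<phi> u"
proof -
  interpret \<phi>: Vector_Spaces.linear scale "(*)" \<phi> by fact
  have "\<phi> u = (\<Sum>b\<in>Basis. coord b u * \<phi> b)"
    by (subst (1) sum_coord[of u, symmetric]) (simp add: \<phi>.sum \<phi>.scale)
  then show ?thesis
    by (simp add: trace_op_def coord_scale mult.commute)
qed

lemma linear_funpow:
  "Vector_Spaces.linear scale scale f \<Longrightarrow> Vector_Spaces.linear scale scale (f ^^ n)"
  by (induction n) (simp_all add: linear_id Vector_Spaces.linear_compose del: id_apply)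

lemma linear_comp_fun:
  "Vector_Spaces.linear scale scale f \<Longrightarrow> Vector_Spaces.linear scale scale g \<Longrightarrow>
   Vector_Spaces.linear scale scale (\<lambda>v. f (g v))"
  using Vector_Spaces.linear_compose[of scale scale g scale f] by (simp add: o_def)

text \<open>By induction on \<open>a + b\<close>, the covector \<open>\<phi>\<close> kills \<open>B1\<^sup>a B2\<^sup>b e\<close>: in the trace of \<open>B1\<^sup>a B1 B2\<^sup>b B2\<close>,
  moving the second factor \<open>B1\<close> to the right end changes the trace by \<open>\<phi> (B1\<^sup>a B2\<^sup>b e)\<close> at each
  of the \<open>b + 1\<close> steps, while the total change vanishes by cyclicity.\<close>

lemma rank_one_ADHM:
  assumes B1: "Vector_Spaces.linear scale scale B1" and B2: "Vector_Spaces.linear scale scale B2"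
    and \<phi>: "Vector_Spaces.linear scale (*) \<phi>"
    and eq: "\<And>v. B1 (B2 v) - B2 (B1 v) + \<phi> v \<odot> e = 0"
    and gen: "generates B1 B2 e"
  shows "\<phi> v = 0"
proof -
  interpret B1: Vector_Spaces.linear scale scale B1 by fact
  interpret B2: Vector_Spaces.linear scale scale B2 by fact
  interpret \<phi>: Vector_Spaces.linear scale "(*)" \<phi> by fact
  define m where "m a b = (B1 ^^ a) ((B2 ^^ b) e)" for a b
  have B21: "B2 (B1 v) = B1 (B2 v) + \<phi> v \<odot> e" for v
    using eq[of v] by (simp add: algebra_simps eq_neg_iff_add_eq_0)
  \<comment> \<open>Moving \<open>B2\<close> past \<open>B1 ^^ a\<close> leaves corrections with
    factors \<open>\<phi> (m a' b)\<close>, \<open>a' < a\<close>, all of lower total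
    degree.\<close>
  have shift: "B2 (m a b) = m a (Suc b)" if "\<And>a' b'. a' + b' < a + b \<Longrightarrow> \<phi> (m a' b') = 0" for a b
    using that
  proof (induction a)
    case 0
    then show ?case by (simp add: m_def)
  next
    case (Suc a)
    have "B2 (m (Suc a) b) = B1 (B2 (m a b)) + \<phi> (m a b) \<odot> e"
      by (simp add: m_def B21)
    also have "\<dots> = m (Suc a) (Suc b)"
      using Suc.IH Suc.prems by (simp add: m_def)
    finally show ?case .
  qed
  have zero: "\<phi> (m a b) = 0" for a b
  proof (induction "a + b" arbitrary: a b rule: less_induct)
    case less
    \<comment> \<open>The bound by \<open>b\<close> keeps all corrections in degree below
      \<open>a + b\<close>, where the induction hypothesis kills them.\<close>
    have shifts: "(B2 ^^ k) (m a l) = m a (l + k)" if "l + k \<le> b" for k l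
      using that
    proof (induction k)
      case (Suc k)
      then show ?case using less by (simp add: shift)
    qed simp
    have lin: "Vector_Spaces.linear scale scale (B1 ^^ n)"
      "Vector_Spaces.linear scale scale (B2 ^^ n)" for n
      by (simp_all add: linear_funpow B1 B2)
    \<comment> \<open>The distinguished \<open>B1\<close> has \<open>l\<close> of the
      \<open>Suc b\<close> factors \<open>B2\<close> on its left, so \<open>T 0\<close> and
      \<open>T (Suc b)\<close> are its extreme positions.\<close>
    define T where "T l = trace_op (\<lambda>v. (B1 ^^ a) ((B2 ^^ l) (B1 ((B2 ^^ (Suc b - l)) v))))" for l
    have step: "T (Suc l) = T l + \<phi> (m a b)" if "l \<le> b" for l
    proof -
      interpret P: Vector_Spaces.linear scale scale "\<lambda>v. (B1 ^^ a) ((B2 ^^ l) v)"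
        using lin(1) lin(2) by (rule linear_comp_fun)
      have lin': "Vector_Spaces.linear scale (*) (\<lambda>v. \<phi> ((B2 ^^ (b - l)) v))"
        using Vector_Spaces.linear_compose[OF lin(2) \<phi>] by (simp add: o_def)
      have "Suc b - l = Suc (b - l)" using that by simp
      moreover have "(B2 ^^ Suc l) w = (B2 ^^ l) (B2 w)" for w
        by (simp add: funpow_swap1)
      ultimately have "T (Suc l) = trace_op (\<lambda>v. (B1 ^^ a) ((B2 ^^ l) (B1 ((B2 ^^ (Suc b - l)) v)))
                          + \<phi> ((B2 ^^ (b - l)) v) \<odot> (B1 ^^ a) ((B2 ^^ l) e))"
        unfolding T_def by (simp add: B21 P.add P.scale del: funpow.simps(2)) (simp add: P.add P.scale B21)
      \<comment> \<open>The increment becomes \<open>\<phi> (m a b)\<close> by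
        \<open>shifts\<close>, independently of \<open>l\<close>.\<close>
      also have "\<dots> = T l + \<phi> ((B2 ^^ (b - l)) (m a l))"
        unfolding T_def trace_op_add by (simp add: trace_op_rank_one[OF lin'] m_def)
      finally show ?thesis
        using that by (simp add: shifts)
    qed
    have "l \<le> Suc b \<Longrightarrow> T l = T 0 + of_nat l * \<phi> (m a b)" for l
      by (induction l) (auto simp: step algebra_simps)
    then have "T (Suc b) = T 0 + of_nat (Suc b) * \<phi> (m a b)"
      by blast
    moreover have "T (Suc b) = T 0"
      using trace_op_commute[OF linear_comp_fun[OF lin(1)[of a] lin(2)[of "Suc b"]] B1]
      by (simp add: T_def funpow_swap1[of B1])
    \<comment> \<open>\<open>Suc b\<close> times \<open>\<phi> (m a b)\<close> is zero, and
      \<open>Suc b\<close> is invertible in characteristic zero.\<close>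
    ultimately show ?case
      by (simp add: of_nat_neq_0 del: of_nat_Suc)
  qed
  \<comment> \<open>Since \<open>\<phi>\<close> kills all monomials, \<open>shift\<close> now holds
    unconditionally and makes their span invariant.\<close>
  have "span {m a b | a b. True} = UNIV"
  proof (rule gen[unfolded generates_def, rule_format])
    have "B1 (m a b) = m (Suc a) b" "B2 (m a b) = m a (Suc b)" for a b
      using shift zero by (simp_all add: m_def)
    then show "B1 ` span {m a b | a b. True} \<subseteq> span {m a b | a b. True}"
      "B2 ` span {m a b | a b. True} \<subseteq> span {m a b | a b. True}"
      by (auto simp: B1.span_image[symmetric] B2.span_image[symmetric] intro!: span_mono) metis+
    have "e = m 0 0" by (simp add: m_def)
    then show "e \<in> span {m a b | a b. True}"
      by (intro span_base) blast
  qed simp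
  then have "v \<in> span {m a b | a b. True}" by simp
  then show ?thesis
    by (rule \<phi>.eq_0_on_span[rotated]) (use zero in auto)
qed

end

section \<open>Analytic families of commuting pairs with a cyclic vector\<close>

text \<open>Models the pencil on one affine chart of the projective line, with coordinate
  \<open>t\<close>.\<close>

locale cyclic_commuting_family = fd_vector_space_char_0 scale Basis
  for scale :: "complex \<Rightarrow> 'b::ab_group_add \<Rightarrow> 'b" (infixr \<open>\<odot>\<close> 75) and Basis +
  fixes B1 B2 :: "complex \<Rightarrow> 'b \<Rightarrow> 'b" and e :: "complex \<Rightarrow> 'b"
  assumes linear_B1: "Vector_Spaces.linear scale scale (B1 t)"
    and linear_B2: "Vector_Spaces.linear scale scale (B2 t)"
    and commute: "B1 t (B2 t v) = B2 t (B1 t v)"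
    and generates: "generates (B1 t) (B2 t) (e t)"
    and analytic_B1: "(\<lambda>t. coord b (B1 t v)) analytic_on {a}"
    and analytic_B2: "(\<lambda>t. coord b (B2 t v)) analytic_on {a}"
    and analytic_e: "(\<lambda>t. coord b (e t)) analytic_on {a}"
begin

text \<open>Polynomials in \<open>B1 t\<close> and \<open>B2 t\<close> with coefficients independent
  of \<open>t\<close>; being functions of \<open>t\<close>, they can be chosen at one point and
  followed to its neighbours.\<close>

inductive_set ops :: "(complex \<Rightarrow> 'b \<Rightarrow> 'b) set" where
  ops_id: "(\<lambda>t v. v) \<in> ops"
| ops_B1: "P \<in> ops \<Longrightarrow> (\<lambda>t v. B1 t (P t v)) \<in> ops"
| ops_B2: "P \<in> ops \<Longrightarrow> (\<lambda>t v. B2 t (P t v)) \<in> ops"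
| ops_add: "P \<in> ops \<Longrightarrow> Q \<in> ops \<Longrightarrow> (\<lambda>t v. P t v + Q t v) \<in> ops"
| ops_scale: "P \<in> ops \<Longrightarrow> (\<lambda>t v. s \<odot> P t v) \<in> ops"

lemma ops_linear: "P \<in> ops \<Longrightarrow> Vector_Spaces.linear scale scale (P t)"
proof (induction rule: ops.induct)
  case ops_id
  then show ?case by (rule linear_ident)
next
  case (ops_B1 P)
  show ?case using linear_B1 ops_B1.IH by (rule linear_comp_fun)
next
  case (ops_B2 P)
  show ?case using linear_B2 ops_B2.IH by (rule linear_comp_fun)
next
  case (ops_add P Q)
  then show ?case by (auto simp: Vector_Spaces.linear_iff algebra_simps scale_right_distrib)
next
  case (ops_scale P s)
  then show ?case by (auto simp: Vector_Spaces.linear_iff scale_right_distrib mult.commute)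
qed

lemma ops_commute: "P \<in> ops \<Longrightarrow> P t (B1 t v) = B1 t (P t v) \<and> P t (B2 t v) = B2 t (P t v)"
proof -
  have add: "B1 t (x + y) = B1 t x + B1 t y" "B2 t (x + y) = B2 t x + B2 t y"
    and scale: "B1 t (s \<odot> x) = s \<odot> B1 t x" "B2 t (s \<odot> x) = s \<odot> B2 t x" for x y s
    using linear_B1[of t] linear_B2[of t] by (simp_all add: Vector_Spaces.linear_iff)
  show "P \<in> ops \<Longrightarrow> P t (B1 t v) = B1 t (P t v) \<and> P t (B2 t v) = B2 t (P t v)"
    by (induction rule: ops.induct) (simp_all add: commute add scale)
qed

lemma analytic_apply:
  assumes "\<And>t. Vector_Spaces.linear scale scale (A t)"
    and "\<And>b v. (\<lambda>t. coord b (A t v)) analytic_on {a}" and "\<And>b. (\<lambda>t. coord b (u t)) analytic_on {a}"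
  shows "(\<lambda>t. coord b (A t (u t))) analytic_on {a}"
  by (subst coord_linear_image[OF assms(1)]) (intro analytic_intros assms)

lemma ops_analytic:
  assumes "P \<in> ops" and u: "\<And>b. (\<lambda>t. coord b (u t)) analytic_on {a}"
  shows "(\<lambda>t. coord b (P t (u t))) analytic_on {a}"
  using assms(1)
proof (induction arbitrary: b rule: ops.induct)
  case ops_id
  then show ?case by (rule u)
next
  case (ops_B1 P)
  show ?case using linear_B1 analytic_B1 ops_B1.IH by (rule analytic_apply)
next
  case (ops_B2 P)
  show ?case using linear_B2 analytic_B2 ops_B2.IH by (rule analytic_apply)
next
  case (ops_add P Q)
  then show ?case by (simp add: coord_add analytic_on_add)
next
  case (ops_scale P s)
  then show ?case by (simp add: coord_scale analytic_on_mult)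
qed

text \<open>The values of these polynomials on the cyclic vector form an invariant subspace.\<close>

lemma ops_generate: "\<exists>P\<in>ops. P t (e t) = v"
proof -
  let ?S = "{P t (e t) | P. P \<in> ops}"
  have mem: "P t (e t) \<in> ?S" if "P \<in> ops" for P
    using that by blast
  have S: "?S = UNIV"
  proof (rule generates[unfolded generates_def, rule_format])
    show "e t \<in> ?S"
      by (rule mem[OF ops_id])
    show "B1 t ` ?S \<subseteq> ?S"
    proof (rule image_subsetI)
      fix x assume "x \<in> ?S"
      then obtain P where "P \<in> ops" "x = P t (e t)"
        by blast
      then show "B1 t x \<in> ?S"
        using mem[OF ops_B1[of P]] by simp
    qed
    show "B2 t ` ?S \<subseteq> ?S"
    proof (rule image_subsetI)
      fix x assume "x \<in> ?S"
      then obtain P where "P \<in> ops" "x = P t (e t)"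
        by blast
      then show "B2 t x \<in> ?S"
        using mem[OF ops_B2[of P]] by simp
    qed
    show "subspace ?S"
    proof (rule subspaceI)
      show "0 \<in> ?S"
        using mem[OF ops_scale[OF ops_id, of 0]] by simp
    next
      fix x y assume "x \<in> ?S" "y \<in> ?S"
      then obtain P Q where "P \<in> ops" "x = P t (e t)" "Q \<in> ops" "y = Q t (e t)"
        by blast
      then show "x + y \<in> ?S"
        using mem[OF ops_add[of P Q]] by simp
    next
      fix s x assume "x \<in> ?S"
      then obtain P where "P \<in> ops" "x = P t (e t)"
        by blast
      then show "s \<odot> x \<in> ?S"
        using mem[OF ops_scale[of P s]] by simp
    qed
  qed
  have "v \<in> ?S"
    unfolding S by simp
  then show ?thesis by blast
qed

text \<open>Choose polynomials \<open>P b\<close> sending \<open>e a\<close> to the basis vectors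
  \<open>b\<close>. The coordinate matrix of the vectors \<open>P b t (e t)\<close> is analytic and
  the identity at \<open>a\<close>, so near \<open>a\<close> there are analytic coefficients
  \<open>x b\<close> expressing \<open>v\<close> through them. The same combination of the
  \<open>P b\<close> commutes with \<open>B1\<close> and \<open>B2\<close>.\<close>

lemma commuting_op_locally:
  obtains P x where "\<forall>b\<in>Basis. P b \<in> ops" and "\<forall>b\<in>Basis. x b analytic_on {a}"
    and "\<forall>\<^sub>F t in nhds a. commuting_op (B1 t) (B2 t) (e t) v (\<lambda>u. \<Sum>b\<in>Basis. x b t \<odot> P b t u)"
proof -
  have "\<forall>b. \<exists>P\<in>ops. P a (e a) = b"
    using ops_generate by blast
  then obtain P where P: "\<And>b. P b \<in> ops" and P_a: "\<And>b. P b a (e a) = b"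
    by metis
  have "\<exists>x. (\<forall>b\<in>Basis. x b analytic_on {a}) \<and>
    (\<forall>\<^sub>F t in nhds a. \<forall>c\<in>Basis. (\<Sum>b\<in>Basis. coord c (P b t (e t)) * x b t) = coord c v)"
    by (rule analytic_at_linear_system)
      (auto simp: finite_Basis P_a coord_Basis intro: ops_analytic P analytic_e)
  then obtain x where x: "\<And>b. b \<in> Basis \<Longrightarrow> x b analytic_on {a}"
    and ev: "\<forall>\<^sub>F t in nhds a. \<forall>c\<in>Basis. (\<Sum>b\<in>Basis. coord c (P b t (e t)) * x b t) = coord c v"
    by blast
  from ev have "\<forall>\<^sub>F t in nhds a.
    commuting_op (B1 t) (B2 t) (e t) v (\<lambda>u. \<Sum>b\<in>Basis. x b t \<odot> P b t u)"
  proof eventually_elim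
    case (elim t)
    interpret B1: Vector_Spaces.linear scale scale "B1 t" by (rule linear_B1)
    interpret B2: Vector_Spaces.linear scale scale "B2 t" by (rule linear_B2)
    have P_add: "P b t (u + w) = P b t u + P b t w"
      and P_scale: "P b t (s \<odot> u) = s \<odot> P b t u" for b u w s
      using ops_linear[OF P[of b], of t] by (simp_all add: Vector_Spaces.linear_iff)
    have "(\<Sum>b\<in>Basis. x b t \<odot> P b t (e t)) = v"
      by (rule eq_if_coord_eq) (use elim in \<open>simp add: coord_sum coord_scale mult.commute\<close>)
    then show ?case
      unfolding commuting_op_def Vector_Spaces.linear_iff
      by (auto simp: P_add P_scale ops_commute[OF P] B1.sum B2.sum B1.scale B2.scale
          scale_right_distrib sum.distrib scale_sum_right mult.commute vector_space_axioms)
  qed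
  with P x show ?thesis by (blast intro: that)
qed

lemma commuting_op_multiplier:
  "commuting_op (B1 t) (B2 t) (e t) v (multiplier (B1 t) (B2 t) (e t) v)"
proof -
  obtain P x where "\<forall>\<^sub>F a in nhds t.
      commuting_op (B1 a) (B2 a) (e a) v (\<lambda>u. \<Sum>b\<in>Basis. x b a \<odot> P b a u)"
    by (rule commuting_op_locally[of t v])
  \<comment> \<open>\<open>nhds t\<close> contains its centre, so the local construction gives
    existence at \<open>t\<close> itself.\<close>
  then have "commuting_op (B1 t) (B2 t) (e t) v (\<lambda>u. \<Sum>b\<in>Basis. x b t \<odot> P b t u)"
    by (rule eventually_nhds_x_imp_x)
  with multiplier_eq[OF generates this] show ?thesis by simp
qed

text \<open>By uniqueness the multiplier coincides near each point with the local analytic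
  formula.\<close>

lemma analytic_multiplier:
  "(\<lambda>t. coord b (multiplier (B1 t) (B2 t) (e t) v u)) analytic_on UNIV"
proof -
  have "(\<lambda>t. coord b (multiplier (B1 t) (B2 t) (e t) v u)) analytic_on {a}" for a
  proof -
    obtain P x where P: "\<forall>b\<in>Basis. P b \<in> ops" and x: "\<forall>b\<in>Basis. x b analytic_on {a}"
      and ev: "\<forall>\<^sub>F t in nhds a.
        commuting_op (B1 t) (B2 t) (e t) v (\<lambda>u. \<Sum>b\<in>Basis. x b t \<odot> P b t u)"
      by (rule commuting_op_locally[of a v])
    from ev have "\<forall>\<^sub>F t in nhds a. coord b (multiplier (B1 t) (B2 t) (e t) v u)
        = (\<Sum>c\<in>Basis. x c t * coord b (P c t u))"
    proof eventually_elim
      case (elim t)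
      show ?case
        by (simp add: multiplier_eq[OF generates elim] coord_sum coord_scale)
    qed
    moreover have "(\<lambda>t. \<Sum>c\<in>Basis. x c t * coord b (P c t u)) analytic_on {a}"
    proof (intro analytic_on_sum analytic_on_mult)
      fix c assume "c \<in> Basis"
      then show "x c analytic_on {a}" "(\<lambda>t. coord b (P c t u)) analytic_on {a}"
        using x P by (auto intro: ops_analytic[where u = "\<lambda>_. u"])
    qed
    ultimately show ?thesis
      by (subst analytic_at_cong) auto
  qed
  then show ?thesis
    by (meson analytic_on_analytic_at)
qed

end


section \<open>Gluing over the projective line\<close>

text \<open>The multiplier entries are entire on the charts \<open>[t:1]\<close> and
  \<open>[1:t]\<close> and differ by \<open>inverse t\<close> on the overlap. They form a section of
  degree -1, hence vanish.\<close>

lemma trivial_if_cyclic_commuting_pencil: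
  fixes scale :: "complex \<Rightarrow> 'b::ab_group_add \<Rightarrow> 'b" and X :: "'b set" and v :: 'b
  assumes "finite_dimensional_vector_space scale X"
    and lin: "Vector_Spaces.linear scale scale B11" "Vector_Spaces.linear scale scale B12"
      "Vector_Spaces.linear scale scale B21" "Vector_Spaces.linear scale scale B22"
    and comm: "\<And>z w v. (z, w) \<noteq> (0, 0) \<Longrightarrow>
      lin_comb scale z w B11 B21 (lin_comb scale z w B12 B22 v) =
      lin_comb scale z w B12 B22 (lin_comb scale z w B11 B21 v)"
    and gen: "\<And>z w. (z, w) \<noteq> (0, 0) \<Longrightarrow>
      fd_vector_space_char_0.generates scale (lin_comb scale z w B11 B21)
        (lin_comb scale z w B12 B22) (scale z e1 + scale w e2)"
  shows "v = 0"
proof -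
  interpret fd_vector_space_char_0 scale X
    using assms(1) by (simp add: fd_vector_space_char_0_def)
  let ?B1 = "\<lambda>z w. lin_comb scale z w B11 B21" and ?B2 = "\<lambda>z w. lin_comb scale z w B12 B22"
    and ?e = "\<lambda>z w. scale z e1 + scale w e2"
  have linear: "Vector_Spaces.linear scale scale (?B1 z w)"
    "Vector_Spaces.linear scale scale (?B2 z w)" for z w
    using lin by (auto simp: Vector_Spaces.linear_iff lin_comb_def scale_right_distrib mult.commute)
  \<comment> \<open>Any analytic lift \<open>(p, q)\<close> avoiding the origin gives a family; the
    two charts are instances.\<close>
  have family: "cyclic_commuting_family scale X (\<lambda>t. ?B1 (p t) (q t)) (\<lambda>t. ?B2 (p t) (q t))
      (\<lambda>t. ?e (p t) (q t))"
    if "\<And>t. (p t, q t) \<noteq> (0, 0)" "\<And>a. p analytic_on {a}" "\<And>a. q analytic_on {a}" for p q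
  proof (intro cyclic_commuting_family.intro cyclic_commuting_family_axioms.intro)
    fix b v a
    show "(\<lambda>t. coord b (?B1 (p t) (q t) v)) analytic_on {a}"
      "(\<lambda>t. coord b (?B2 (p t) (q t) v)) analytic_on {a}"
      "(\<lambda>t. coord b (?e (p t) (q t))) analytic_on {a}"
      unfolding lin_comb_def coord_add coord_scale by (intro analytic_intros that)+
  qed (use fd_vector_space_char_0_axioms linear comm gen that(1) in auto)
  interpret chart0: cyclic_commuting_family scale X "\<lambda>t. ?B1 t 1" "\<lambda>t. ?B2 t 1" "\<lambda>t. ?e t 1"
    using family[of "\<lambda>t. t" "\<lambda>t. 1"] by simp
  interpret chart1: cyclic_commuting_family scale X "\<lambda>t. ?B1 1 t" "\<lambda>t. ?B2 1 t" "\<lambda>t. ?e 1 t"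
    using family[of "\<lambda>t. 1" "\<lambda>t. t"] by simp
  let ?M = "\<lambda>z w. multiplier (?B1 z w) (?B2 z w) (?e z w) v"
  \<comment> \<open>The coordinates \<open>(t, 1)\<close> are \<open>t\<close> times
    \<open>(1, inverse t)\<close>.\<close>
  have glue: "?M t 1 u = scale (inverse t) (?M 1 (inverse t) u)" if "t \<noteq> 0" for t u
  proof -
    have "commuting_op (\<lambda>u. scale t (?B1 1 (inverse t) u)) (\<lambda>u. scale t (?B2 1 (inverse t) u))
        (scale t (?e 1 (inverse t))) v (\<lambda>u. scale (inverse t) (?M 1 (inverse t) u))"
      using chart1.commuting_op_multiplier that linear by (rule commuting_op_rescale)
    moreover have "(\<lambda>u. scale t (?B1 1 (inverse t) u)) = ?B1 t 1"
      "(\<lambda>u. scale t (?B2 1 (inverse t) u)) = ?B2 t 1" "scale t (?e 1 (inverse t)) = ?e t 1"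
      using that by (auto simp: lin_comb_def scale_right_distrib)
    ultimately have "commuting_op (?B1 t 1) (?B2 t 1) (?e t 1) v
        (\<lambda>u. scale (inverse t) (?M 1 (inverse t) u))"
      by simp
    from multiplier_eq[OF chart0.generates this] show ?thesis
      by simp
  qed
  have zero: "coord b (?M t 1 u) = 0" for b t u
    using chart0.analytic_multiplier chart1.analytic_multiplier
    by (rule degree_minus_one_section_eq_0[where h = "\<lambda>t. coord b (?M 1 t u)"])
      (subst glue, simp, simp only: coord_scale mult.commute)
  \<comment> \<open>One point suffices: the zero operator sends the cyclic vector to
    \<open>v\<close>.\<close>
  have "?M 0 1 (?e 0 1) = v"
    using chart0.commuting_op_multiplier[of 0 v] unfolding commuting_op_def by blast
  then have "coord b v = coord b 0" for b
    using zero[where t = 0 and u = "?e 0 1" and b = b] by (simp only: representation_zero)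
  then show ?thesis
    by (rule eq_if_coord_eq)
qed

section \<open>Reduction of the theorem to a cyclic commuting pencil\<close>

lemma (in vector_space) dim_1_obtains:
  assumes "dim UNIV = 1"
  obtains w where "\<And>v. v \<in> span {w}" "w \<noteq> 0"
proof -
  obtain B where B: "independent B" "UNIV \<subseteq> span B" "card B = 1"
    using basis_exists[of UNIV] assms by metis
  then obtain w where "B = {w}"
    by (auto simp: card_1_singleton_iff)
  then show ?thesis
    using B that[of w] by auto
qed

theorem proposition5:
  fixes sV :: "complex \<Rightarrow> 'v::ab_group_add \<Rightarrow> 'v"
    and sW :: "complex \<Rightarrow> 'w::ab_group_add \<Rightarrow> 'w"
    and c r :: nat
  assumes "vector_space sV" and "vector_space sW"
    and "vector_space.dim sV (UNIV :: 'v set) = c" and "c \<ge> 1"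
    and "vector_space.dim sW (UNIV :: 'w set) = r" and "r = 1"
  shows "\<not> (\<exists>B11 B12 B21 B22 i1 i2 j1 j2.
      Vector_Spaces.linear sV sV B11 \<and> Vector_Spaces.linear sV sV B12 \<and>
      Vector_Spaces.linear sV sV B21 \<and> Vector_Spaces.linear sV sV B22 \<and>
      Vector_Spaces.linear sW sV i1 \<and> Vector_Spaces.linear sW sV i2 \<and>
      Vector_Spaces.linear sV sW j1 \<and> Vector_Spaces.linear sV sW j2 \<and>
      complex_ADHM B11 B12 B21 B22 i1 i2 j1 j2 \<and>
      C_stable sV sW B11 B12 B21 B22 i1 i2 j1 j2)"
proof (intro notI, elim exE conjE)
  fix B11 B12 B21 B22 i1 i2 j1 j2
  assume B: "Vector_Spaces.linear sV sV B11" "Vector_Spaces.linear sV sV B12"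
      "Vector_Spaces.linear sV sV B21" "Vector_Spaces.linear sV sV B22"
    and i: "Vector_Spaces.linear sW sV i1" "Vector_Spaces.linear sW sV i2"
    and j: "Vector_Spaces.linear sV sW j1" "Vector_Spaces.linear sV sW j2"
    and ADHM: "complex_ADHM B11 B12 B21 B22 i1 i2 j1 j2"
    and stable: "C_stable sV sW B11 B12 B21 B22 i1 i2 j1 j2"
  interpret V: vector_space sV by fact
  interpret W: vector_space sW by fact
  obtain X where X: "V.independent X" "UNIV \<subseteq> V.span X" "card X = c"
    using V.basis_exists[of UNIV] assms(3) by metis
  \<comment> \<open>Infinite sets and the empty set have cardinality 0, so \<open>c \<ge> 1\<close>
    excludes both.\<close>
  then have "finite X" "X \<noteq> {}"
    using assms(4) by (auto intro: card_ge_0_finite)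
  then interpret V: fd_vector_space_char_0 sV X
    using X by unfold_locales auto
  obtain w0 where w0: "\<And>x. x \<in> W.span {w0}" "w0 \<noteq> 0"
    using W.dim_1_obtains assms(5,6) by metis
  then have "\<forall>x. \<exists>s. x = sW s w0"
    by (auto simp: W.span_singleton)
  \<comment> \<open>\<open>\<kappa>\<close> identifies \<open>W\<close> with the scalars:
    \<open>i\<close> becomes a vector and \<open>j\<close> a covector.\<close>
  then obtain \<kappa> where \<kappa>: "\<And>x. x = sW (\<kappa> x) w0"
    by metis
  have \<kappa>_eqI: "\<kappa> x = s" if "x = sW s w0" for x s
    using \<kappa>[of x] that w0(2) by (metis W.scale_cancel_right)
  have \<kappa>_add: "\<kappa> (x + y) = \<kappa> x + \<kappa> y" for x y
    by (rule \<kappa>_eqI) (metis \<kappa> W.scale_left_distrib)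
  have \<kappa>_scale: "\<kappa> (sW s x) = s * \<kappa> x" for s x
    by (rule \<kappa>_eqI) (metis \<kappa> W.scale_scale)
  let ?B1 = "\<lambda>z w. lin_comb sV z w B11 B21" and ?B2 = "\<lambda>z w. lin_comb sV z w B12 B22"
    and ?i = "\<lambda>z w. lin_comb sV z w i1 i2" and ?j = "\<lambda>z w. lin_comb sW z w j1 j2"
  have B_lin: "Vector_Spaces.linear sV sV (?B1 z w)" "Vector_Spaces.linear sV sV (?B2 z w)"
    and i_lin: "Vector_Spaces.linear sW sV (?i z w)"
    and j_lin: "Vector_Spaces.linear sV sW (?j z w)" for z w
    using B i j
    by (auto simp: Vector_Spaces.linear_iff lin_comb_def V.scale_right_distrib W.scale_right_distrib
        mult.commute)
  have i_eq: "?i z w x = sV (\<kappa> x) (?i z w w0)" for z w x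
    using i_lin[of z w] \<kappa>[of x] by (metis Vector_Spaces.linear_iff)
  have vector_space_complex: "vector_space ((*) :: complex \<Rightarrow> complex \<Rightarrow> complex)"
    by unfold_locales (simp_all add: algebra_simps)
  have \<kappa>j: "Vector_Spaces.linear sV (*) (\<lambda>v. \<kappa> (?j z w v))" for z w
    using j_lin[of z w] vector_space_complex
    by (auto simp: Vector_Spaces.linear_iff \<kappa>_add \<kappa>_scale)
  \<comment> \<open>The coefficients of \<open>z * z\<close>, \<open>w * w\<close> and
    \<open>z * w\<close> are the three complex ADHM equations.\<close>
  have eq: "?B1 z w (?B2 z w v) - ?B2 z w (?B1 z w v) + sV (\<kappa> (?j z w v)) (?i z w w0) = 0" for z w v
  proof -
    have "?B1 z w (?B2 z w v) - ?B2 z w (?B1 z w v) + ?i z w (?j z w v) =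
      sV (z * z) (commutator B11 B12 v + i1 (j1 v)) + sV (w * w) (commutator B21 B22 v + i2 (j2 v)) +
      sV (z * w) (commutator B11 B22 v + commutator B21 B12 v + i1 (j2 v) + i2 (j1 v))"
      using B i
      by (simp add: lin_comb_def commutator_def Vector_Spaces.linear_iff V.scale_right_distrib
          V.scale_right_diff_distrib algebra_simps)
    also have "\<dots> = 0"
      using ADHM by (simp add: complex_ADHM_def)
    finally show ?thesis
      using i_eq by metis
  qed
  \<comment> \<open>A subspace containing the image of \<open>w0\<close> contains the whole range of
    \<open>?i z w\<close>, so stability applies.\<close>
  have gen: "V.generates (?B1 z w) (?B2 z w) (?i z w w0)" if "(z, w) \<noteq> (0, 0)" for z w
    unfolding V.generates_def
  proof (intro allI impI)
    fix S assume S: "V.subspace S" "?B1 z w ` S \<subseteq> S" "?B2 z w ` S \<subseteq> S" "?i z w w0 \<in> S"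
    then have "range (?i z w) \<subseteq> S"
      by (subst i_eq[abs_def]) (auto intro: V.subspace_scale)
    with S stable that show "S = UNIV"
      unfolding C_stable_def adhm_stable_def by blast
  qed
  \<comment> \<open>The covector \<open>\<kappa>\<close> composed with \<open>?j z w\<close>
    vanishes by the trace argument, leaving a zero commutator.\<close>
  have comm: "?B1 z w (?B2 z w v) = ?B2 z w (?B1 z w v)" if "(z, w) \<noteq> (0, 0)" for z w v
    using eq[of z w v] V.rank_one_ADHM[OF B_lin \<kappa>j eq gen[OF that]] by simp
  have "v = 0" for v :: 'v
  proof (rule trivial_if_cyclic_commuting_pencil[OF V.finite_dimensional_vector_space_axioms B])
    fix z w :: complex and v assume "(z, w) \<noteq> (0, 0)"
    then show "?B1 z w (?B2 z w v) = ?B2 z w (?B1 z w v)"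
      "V.generates (?B1 z w) (?B2 z w) (sV z (i1 w0) + sV w (i2 w0))"
      using comm gen[unfolded lin_comb_def[of sV _ _ i1]] by blast+
  qed
  then have "X \<subseteq> {0}" by blast
  with \<open>X \<noteq> {}\<close> have "0 \<in> X" by blast
  then show False
    using X(1) V.dependent_zero by blast
qed

end
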